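(* Let $D$ be a set, let $e$ be an expression whose operation symbols are unary or binary, and let $I$ be an interpretation for $e$ with domain $D$. Let $I'$ be a set extension of $I$. Let $f$ be the function computed by $e$ under $I$ and let $f'$ be the function computed by $e$ under $I'$. Then $f'$ is a set extension of $f$.
   Context: Functions are partial: $f\in S\to T$ means that $f$ associates each element of a subset $\mathrm{dom}(f)\subset S$ with a unique element of $T$; $f$ is total if $\mathrm{dom}(f)=S$. For $X\subset S$, $\{f(x)\mid x\in X\}$ means the set of $y\in T$ such that $f$ associates some $x\in X$ with $y$ (points where $f$ is undefined contribute nothing). The composition $g\circ f$ of $f\in S\to T$ and $g\in T\to U$ associates $x$ with $z$ iff there is $y$ with $f$ mapping $x$ to $y$ and $g$ mapping $y$ to $z$. For $f_1\in S_1\to T_1$, $f_2\in S_2\to T_2$, the function $f_1\times f_2\in S_1\times S_2\to T_1\times T_2$ has domain $\mathrm{dom}(f_1)\times\mathrm{dom}(f_2)$ and maps $\langle x_1,x_2\rangle$ to $\langle f_1(x_1),f_2(x_2)\rangle$. $\mathcal{P}(S)$ is the power set of $S$. Expressions: a variable is an expression; if $E$ is an expression and $\varphi$ a unary operation symbol, then $\varphi E$ is an expression; if $E_1,E_2$ are expressions and $\diamond$ is a binary operation symbol, then $E_1\diamond E_2$ is an expression. The variable sequence of $e$ is the sequence $\langle v_1,\ldots,v_n\rangle$ of its distinct variables in order of first occurrence. An interpretation for an expression consists of a set $D$ (its domain) and a map $M$ sending each $n$-ary operation symbol in the expression to a (partial) function in $D^n\to D$, $n\in\{1,2\}$. Distribution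 function: let $e_1,e_2$ have variable sequences $\langle v_1,\ldots,v_m\rangle$ and $\langle w_1,\ldots,w_n\rangle$, and let $w_{j_1},\ldots,w_{j_q}$ ($j_1<\cdots<j_q$) be those $w_j$ that do not occur in $e_1$ (so the variable sequence of $e_1\diamond e_2$ is $\langle v_1,\ldots,v_m,w_{j_1},\ldots,w_{j_q}\rangle$). The distribution function $\delta\in D^{m+q}\to D^m\times D^n$ for $\langle e_1,e_2\rangle$ and $D$ maps $\langle x_1,\ldots,x_m,y_{j_1},\ldots,y_{j_q}\rangle$ to $\langle\langle x_1,\ldots,x_m\rangle,\langle y_1,\ldots,y_n\rangle\rangle$, where for each $w_i$ occurring in $e_1$, say $w_i=v_k$, one has $y_i=x_k$. Function computed by $e$ under an interpretation with domain $D$ and map $M$, by recursion: if $e$ is a variable, it is the identity on $D$; if $e$ is $\varphi e_1$, it is $M(\varphi)\circ f_1$ where $f_1$ is the function computed by $e_1$; if $e$ is $e_1\diamond e_2$, it is $M(\diamond)\circ(f_1\times f_2)\circ\delta$, where $f_1,f_2$ are the functions computed by $e_1,e_2$ and $\delta$ is the distribution function for $\langle e_1,e_2\rangle$ and $D$. It is a function in $D^k\to D$ where $k$ is the number of distinct variables of $e$. Set extension of a function: for $f\in S\to T$, a total function $F\in\mathcal{P}(S)\to\mathcal{P}(T)$ is a set extension of $f$ iff $\{f(x)\mid x\in X\}\subset F(X)$ for all $X\subset S$. When $S=D^n$ and $F$ takes $n$-tuples of subsets of $D$ as arguments (i.e. $F\in\mathcal{P}(D)^n\to\mathcal{P}(D)$,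 total), a tuple $\langle A_1,\ldots,A_n\rangle$ stands for the set $A_1\times\cdots\times A_n$, and the condition reads $\{f(x)\mid x\in A_1\times\cdots\times A_n\}\subset F(A_1,\ldots,A_n)$ for all $A_1,\ldots,A_n\subset D$. A set extension $I'$ of an interpretation $I$ with domain $D$ and map $M$ is an interpretation with domain $\mathcal{P}(D)$ that maps each operation symbol $p$ to a set extension of $M(p)$. *)

theory Defs
  imports Main "HOL-Library.NList"
begin

text \<open>
  Partial functions are option-valued maps. The tuples in \<open>D\<^sup>n\<close> are the lists in
  \<open>nlists n D\<close>; \<open>D\<^sup>1\<close> is identified with \<open>D\<close> via \<open>x \<mapsto> [x]\<close> and
  \<open>D \<times> D\<close> with \<open>D\<^sup>2\<close> via \<open>(x, y) \<mapsto> [x, y]\<close>.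
\<close>

definition pfuns :: "'x set \<Rightarrow> 'y set \<Rightarrow> ('x \<rightharpoonup> 'y) set" where
  "pfuns S T = {f. dom f \<subseteq> S \<and> ran f \<subseteq> T}"

definition pprod :: "('x1 \<rightharpoonup> 'y1) \<Rightarrow> ('x2 \<rightharpoonup> 'y2) \<Rightarrow> ('x1 \<times> 'x2 \<rightharpoonup> 'y1 \<times> 'y2)"
  (infixr \<open>\<times>\<^sub>p\<close> 80) where
  "f1 \<times>\<^sub>p f2 = (\<lambda>(x1, x2). case (f1 x1, f2 x2) of
     (Some y1, Some y2) \<Rightarrow> Some (y1, y2) | _ \<Rightarrow> None)"

datatype ('u, 'b) opsym = Unary 'u | Binary 'b

fun arity :: "('u, 'b) opsym \<Rightarrow> nat" where
  "arity (Unary _) = 1"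
| "arity (Binary _) = 2"

datatype ('v, 'u, 'b) expr =
    Var 'v
  | UnOp 'u "('v, 'u, 'b) expr"
  | BinOp "('v, 'u, 'b) expr" 'b "('v, 'u, 'b) expr"

fun ops :: "('v, 'u, 'b) expr \<Rightarrow> ('u, 'b) opsym set" where
  "ops (Var v) = {}"
| "ops (UnOp u e) = insert (Unary u) (ops e)"
| "ops (BinOp e1 b e2) = insert (Binary b) (ops e1 \<union> ops e2)"

fun var_occs :: "('v, 'u, 'b) expr \<Rightarrow> 'v list" where
  "var_occs (Var v) = [v]"
| "var_occs (UnOp u e) = var_occs e"
| "var_occs (BinOp e1 b e2) = var_occs e1 @ var_occs e2"

text \<open>\<open>remdups\<close> keeps last occurrences, hence the two reversals.\<close>

definition var_seq :: "('v, 'u, 'b) expr \<Rightarrow> 'v list" where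
  "var_seq e = rev (remdups (rev (var_occs e)))"

definition is_interp ::
  "('v, 'u, 'b) expr \<Rightarrow> 'd set \<Rightarrow> (('u, 'b) opsym \<Rightarrow> 'd list \<rightharpoonup> 'd) \<Rightarrow> bool" where
  "is_interp e D M \<longleftrightarrow> (\<forall>p\<in>ops e. M p \<in> pfuns (nlists (arity p) D) D)"

text \<open>
  The argument \<open>zs\<close> assigns values to the variable sequence of a binary expression
  with operands \<open>e1\<close> and \<open>e2\<close>; the result consists of the values of the variable
  sequences of \<open>e1\<close> and of \<open>e2\<close> under this assignment.
  See \<open>distribution_iff\<close> below for the description by components.
\<close>

definition distribution ::
  "('v, 'u, 'b) expr \<Rightarrow> ('v, 'u, 'b) expr \<Rightarrow> 'd set \<Rightarrow> 'd list \<rightharpoonup> 'd list \<times> 'd list" where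
  "distribution e1 e2 D zs =
     (let vs = var_seq e1;
          ws = var_seq e2;
          us = vs @ filter (\<lambda>w. w \<notin> set vs) ws;
          val = (\<lambda>v. the (map_of (zip us zs) v))
      in if zs \<in> nlists (length us) D then Some (map val vs, map val ws) else None)"

fun compute ::
  "'d set \<Rightarrow> (('u, 'b) opsym \<Rightarrow> 'd list \<rightharpoonup> 'd) \<Rightarrow> ('v, 'u, 'b) expr \<Rightarrow> 'd list \<rightharpoonup> 'd" where
  "compute D M (Var v) = (\<lambda>xs. if xs \<in> nlists 1 D then Some (hd xs) else None)"
| "compute D M (UnOp u e) = M (Unary u) \<circ>\<^sub>m (\<lambda>y. Some [y]) \<circ>\<^sub>m compute D M e"
| "compute D M (BinOp e1 b e2) =
     M (Binary b) \<circ>\<^sub>m (\<lambda>(y1, y2). Some [y1, y2])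
       \<circ>\<^sub>m (compute D M e1 \<times>\<^sub>p compute D M e2) \<circ>\<^sub>m distribution e1 e2 D"

text \<open>
  Set extensions of functions in \<open>D\<^sup>n \<rightarrow> D\<close>; \<open>listset [A\<^sub>1, \<dots>, A\<^sub>n]\<close> is
  \<open>A\<^sub>1 \<times> \<dots> \<times> A\<^sub>n\<close>, and \<open>the\<close> is harmless because \<open>F\<close> is total on \<open>(Pow D)\<^sup>n\<close>.
\<close>

definition set_extension ::
  "nat \<Rightarrow> 'd set \<Rightarrow> ('d list \<rightharpoonup> 'd) \<Rightarrow> ('d set list \<rightharpoonup> 'd set) \<Rightarrow> bool" where
  "set_extension n D f F \<longleftrightarrow>
     f \<in> pfuns (nlists n D) D \<and>
     F \<in> pfuns (nlists n (Pow D)) (Pow D) \<and>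
     dom F = nlists n (Pow D) \<and>
     (\<forall>As \<in> nlists n (Pow D). {y. \<exists>xs \<in> listset As. f xs = Some y} \<subseteq> the (F As))"

definition interp_set_extension ::
  "('v, 'u, 'b) expr \<Rightarrow> 'd set \<Rightarrow> (('u, 'b) opsym \<Rightarrow> 'd list \<rightharpoonup> 'd)
    \<Rightarrow> (('u, 'b) opsym \<Rightarrow> 'd set list \<rightharpoonup> 'd set) \<Rightarrow> bool" where
  "interp_set_extension e D M M' \<longleftrightarrow>
     is_interp e (Pow D) M' \<and>
     (\<forall>p\<in>ops e. set_extension (arity p) D (M p) (M' p))"

text \<open>As conditional simp rules these loop together with \<open>nlists_def\<close>.\<close>

declare nlistsE_length [simp del] nlistsE_set [simp del]

lemma var_seq_distinct: "distinct (var_seq e)"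
  by (simp add: var_seq_def)

lemma rev_remdups_append:
  "rev (remdups (rev (xs @ ys))) =
     rev (remdups (rev xs)) @ filter (\<lambda>y. y \<notin> set xs) (rev (remdups (rev ys)))"
proof -
  have *: "remdups (as @ bs) = filter (\<lambda>a. a \<notin> set bs) (remdups as) @ remdups bs"
    for as bs :: "'a list"
    by (induction as) auto
  show ?thesis by (simp add: * rev_filter)
qed

lemma var_seq_simps:
  "var_seq (Var v) = [v]"
  "var_seq (UnOp u e) = var_seq e"
  "var_seq (BinOp e1 b e2) =
     var_seq e1 @ filter (\<lambda>w. w \<notin> set (var_seq e1)) (var_seq e2)"
  using rev_remdups_append[of "var_occs e1" "var_occs e2"]
  by (auto simp: var_seq_def)

lemma distribution_iff:
  fixes e1 e2 :: "('v, 'u, 'b) expr" and D :: "'d set"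
  defines "vs \<equiv> var_seq e1" and "ws \<equiv> var_seq e2"
  shows "distribution e1 e2 D zs = Some (xs, ys) \<longleftrightarrow>
    xs \<in> nlists (length vs) D \<and> ys \<in> nlists (length ws) D \<and>
    (\<forall>i < length ws. \<forall>k < length vs. ws ! i = vs ! k \<longrightarrow> ys ! i = xs ! k) \<and>
    zs = xs @ map snd (filter (\<lambda>(w, y). w \<notin> set vs) (zip ws ys))"
proof -
  define fs where "fs = filter (\<lambda>w. w \<notin> set vs) ws"
  define us where "us = vs @ fs"
  define val where "val = (\<lambda>zs :: 'd list. \<lambda>v. the (map_of (zip us zs) v))"
  have dvs: "distinct vs" and dws: "distinct ws"
    by (simp_all add: vs_def ws_def var_seq_distinct)
  then have dus: "distinct us" by (auto simp: us_def fs_def)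
  have sub: "set ws \<subseteq> set us" by (auto simp: us_def fs_def)
  have dist: "distribution e1 e2 D zs =
      (if zs \<in> nlists (length us) D then Some (map (val zs) vs, map (val zs) ws) else None)"
    for zs :: "'d list"
    by (simp add: distribution_def us_def fs_def val_def vs_def ws_def Let_def)
  have mval: "map (val zs) us = zs" if "length zs = length us" for zs :: "'d list"
  proof (rule nth_equalityI)
    show "length (map (val zs) us) = length zs" using that by simp
    fix i assume "i < length (map (val zs) us)"
    then show "map (val zs) us ! i = zs ! i"
      using that dus by (simp add: val_def map_of_zip_nth)
  qed
  have flt: "map snd (filter (\<lambda>(w, y). w \<notin> set vs) (zip ws (map g ws))) = map g fs"
    for g :: "'v \<Rightarrow> 'd"
    unfolding fs_def by (induction ws) auto
  show ?thesis (is "?L \<longleftrightarrow> ?R")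
  proof
    assume ?L
    then have zs: "zs \<in> nlists (length us) D" and xs: "xs = map (val zs) vs"
      and ys: "ys = map (val zs) ws"
      by (auto simp: dist split: if_splits)
    have m: "map (val zs) us = zs" by (rule mval) (use zs in \<open>simp add: nlists_def\<close>)
    have "set (map (val zs) us) \<subseteq> D" unfolding m using zs by (auto simp: nlists_def)
    then have "val zs ` set us \<subseteq> D" by simp
    then have "xs \<in> nlists (length vs) D" "ys \<in> nlists (length ws) D"
      using sub by (auto simp: nlists_def xs ys us_def)
    moreover have "zs = xs @ map snd (filter (\<lambda>(w, y). w \<notin> set vs) (zip ws ys))"
      unfolding ys flt xs using m by (simp add: us_def)
    moreover have "\<forall>i < length ws. \<forall>k < length vs. ws ! i = vs ! k \<longrightarrow> ys ! i = xs ! k"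
      by (simp add: xs ys)
    ultimately show ?R by blast
  next
    assume R: ?R
    define g where "g = (\<lambda>v. if v \<in> set vs then the (map_of (zip vs xs) v)
      else the (map_of (zip ws ys) v))"
    have lx: "length xs = length vs" and ly: "length ys = length ws"
      using R by (auto simp: nlists_def)
    have xs: "xs = map g vs"
      by (rule nth_equalityI) (use lx dvs in \<open>auto simp: g_def map_of_zip_nth\<close>)
    have ys: "ys = map g ws"
    proof (rule nth_equalityI)
      show "length ys = length (map g ws)" using ly by simp
      fix i assume "i < length ys"
      then have i: "i < length ws" using ly by simp
      show "ys ! i = map g ws ! i"
      proof (cases "ws ! i \<in> set vs")
        case True
        then obtain k where k: "k < length vs" "ws ! i = vs ! k"
          by (metis in_set_conv_nth)
        then have "ys ! i = xs ! k" using R i by blast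
        then show ?thesis using i k by (simp add: xs)
      next
        case False
        then show ?thesis using i ly dws by (simp add: g_def map_of_zip_nth)
      qed
    qed
    have zs: "zs = map g us"
      using R by (simp add: ys flt us_def) (simp add: xs)
    have "set zs \<subseteq> D"
    proof -
      have "set xs \<subseteq> D" "set ys \<subseteq> D" using R by (simp_all add: nlists_def)
      then show ?thesis by (auto simp: zs xs ys us_def fs_def)
    qed
    then have "zs \<in> nlists (length us) D" by (simp add: nlists_def zs)
    moreover have "\<forall>u\<in>set us. val zs u = g u"
      using mval[of zs] by (simp add: zs)
    ultimately show ?L using sub by (auto simp: dist xs ys us_def)
  qed
qed

end

theory Submission
  imports Defs
begin

text \<open>
  Structural induction on the expression. For \<open>e\<^sub>1 \<diamond> e\<^sub>2\<close>, the distribution function only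
  copies and rearranges components, so it maps a tuple that lies componentwise in \<open>As\<close>
  to a pair of tuples lying componentwise in the two parts of the distribution of \<open>As\<close>;
  the induction hypotheses and the set extension of \<open>\<diamond>\<close> then apply.
\<close>

lemma listset_iff_list_all2: "xs \<in> listset As \<longleftrightarrow> list_all2 (\<in>) xs As"
  by (induction As arbitrary: xs) (auto simp: set_Cons_def list_all2_Cons2)

text \<open>Working form of the definition: an explicit value \<open>B\<close> replaces
  \<open>the\<close>, and \<open>list_all2\<close> replaces the product \<open>listset\<close>.
  Componentwise membership as a relator on lists is what later passes through \<open>map\<close> and
  \<open>zip\<close>.\<close>

lemma set_extension_iff:
  "set_extension n D f F \<longleftrightarrow>
     (\<forall>xs y. f xs = Some y \<longrightarrow> xs \<in> nlists n D \<and> y \<in> D) \<and>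
     (\<forall>As. As \<notin> nlists n (Pow D) \<longrightarrow> F As = None) \<and>
     (\<forall>As \<in> nlists n (Pow D). \<exists>B. F As = Some B \<and> B \<subseteq> D \<and>
        (\<forall>xs y. list_all2 (\<in>) xs As \<longrightarrow> f xs = Some y \<longrightarrow> y \<in> B))"
  (is "?L \<longleftrightarrow> ?R")
proof
  assume L: ?L
  then have f: "dom f \<subseteq> nlists n D" "ran f \<subseteq> D" and ran: "ran F \<subseteq> Pow D"
    and dom: "dom F = nlists n (Pow D)"
    by (auto simp: set_extension_def pfuns_def)
  have ext: "y \<in> the (F As)"
    if "As \<in> nlists n (Pow D)" "list_all2 (\<in>) xs As" "f xs = Some y" for As xs y
  proof -
    have "{y. \<exists>xs \<in> listset As. f xs = Some y} \<subseteq> the (F As)"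
      using L that(1) by (simp add: set_extension_def)
    then show ?thesis using that(2,3) listset_iff_list_all2[of xs As] by blast
  qed
  have "\<exists>B. F As = Some B \<and> B \<subseteq> D \<and>
      (\<forall>xs y. list_all2 (\<in>) xs As \<longrightarrow> f xs = Some y \<longrightarrow> y \<in> B)"
    if As: "As \<in> nlists n (Pow D)" for As
  proof -
    obtain B where B: "F As = Some B" using As dom by blast
    then have "B \<subseteq> D" using ran by (auto simp: ran_def)
    then show ?thesis using B ext[OF As] by auto
  qed
  moreover have "F As = None" if "As \<notin> nlists n (Pow D)" for As
    using that dom by blast
  moreover have "xs \<in> nlists n D \<and> y \<in> D" if "f xs = Some y" for xs y
    using that f by (auto simp: ran_def)
  ultimately show ?R by blast
next
  assume ?R
  then have f: "\<And>xs y. f xs = Some y \<Longrightarrow> xs \<in> nlists n D \<and> y \<in> D"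
    and undef: "\<And>As. As \<notin> nlists n (Pow D) \<Longrightarrow> F As = None"
    and total: "\<And>As. As \<in> nlists n (Pow D) \<Longrightarrow> \<exists>B. F As = Some B \<and> B \<subseteq> D \<and>
      (\<forall>xs y. list_all2 (\<in>) xs As \<longrightarrow> f xs = Some y \<longrightarrow> y \<in> B)"
    by blast+
  have "As \<in> dom F \<longleftrightarrow> As \<in> nlists n (Pow D)" for As
    using undef[of As] total[of As] by (cases "As \<in> nlists n (Pow D)") auto
  then have dom: "dom F = nlists n (Pow D)" by blast
  moreover have "ran F \<subseteq> Pow D"
  proof
    fix B assume "B \<in> ran F"
    then obtain As where "F As = Some B" by (auto simp: ran_def)
    then show "B \<in> Pow D" using dom total[of As] by auto
  qed
  moreover have "dom f \<subseteq> nlists n D" "ran f \<subseteq> D" using f by (auto simp: ran_def)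
  moreover have "{y. \<exists>xs \<in> listset As. f xs = Some y} \<subseteq> the (F As)"
    if As: "As \<in> nlists n (Pow D)" for As
  proof -
    obtain B where "F As = Some B"
      "\<forall>xs y. list_all2 (\<in>) xs As \<longrightarrow> f xs = Some y \<longrightarrow> y \<in> B"
      using total[OF As] by blast
    then show ?thesis by (auto simp: listset_iff_list_all2)
  qed
  ultimately show ?L by (auto simp: set_extension_def pfuns_def)
qed

lemma set_extension_SomeD:
  assumes "set_extension n D f F" and "f xs = Some y"
  shows "xs \<in> nlists n D" and "y \<in> D"
  using assms by (simp_all add: set_extension_iff)

lemma set_extension_applyE:
  assumes "set_extension n D f F" and "As \<in> nlists n (Pow D)"
  obtains B where "F As = Some B" and "B \<subseteq> D"
    and "\<forall>xs y. list_all2 (\<in>) xs As \<longrightarrow> f xs = Some y \<longrightarrow> y \<in> B"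
  using assms unfolding set_extension_iff by blast

text \<open>Both association lists carry the same keys, so the two lookups stop at the same
  position, the first occurrence of \<open>u\<close>, where the values are related. The length
  condition ensures that this position exists in \<open>xs\<close> and \<open>ys\<close>.\<close>

lemma list_all2_map_of_zip:
  assumes "list_all2 P xs ys" and "length us = length xs" and "u \<in> set us"
  shows "P (the (map_of (zip us xs) u)) (the (map_of (zip us ys) u))"
  using assms
proof (induction arbitrary: us rule: list_all2_induct)
  case (Cons x xs y ys)
  then show ?case by (cases us) auto
qed simp

text \<open>The length tested inside \<open>distribution\<close> is that of the variable sequence of
  the binary expression. This links the domain of the distribution function to the domain demanded
  of the computed function.\<close>

lemma distribution_eq_None_iff:
  "distribution e1 e2 D zs = None \<longleftrightarrow> zs \<notin> nlists (length (var_seq (BinOp e1 b e2))) D"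
  by (simp add: distribution_def var_seq_simps Let_def)

text \<open>Every output component is the lookup of a variable in the input, and both inputs are
  indexed by the same variable list. Keeping \<open>D\<close>, \<open>E\<close> and \<open>P\<close>
  general allows \<open>D\<close>, \<open>Pow D\<close> and membership later.\<close>

lemma distribution_list_all2:
  assumes "distribution e1 e2 D xs = Some (xs1, xs2)"
    and "distribution e1 e2 E ys = Some (ys1, ys2)"
    and "list_all2 P xs ys"
  shows "list_all2 P xs1 ys1 \<and> list_all2 P xs2 ys2"
proof -
  let ?us = "var_seq e1 @ filter (\<lambda>w. w \<notin> set (var_seq e1)) (var_seq e2)"
  have len: "length ?us = length xs"
    using assms(1) by (auto simp: distribution_def Let_def nlists_def split: if_splits)
  have "list_all2 P (map (\<lambda>v. the (map_of (zip ?us xs) v)) vs)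
      (map (\<lambda>v. the (map_of (zip ?us ys) v)) vs)"
    if "set vs \<subseteq> set ?us" for vs
    \<comment> \<open>Both lists are maps over the same \<open>vs\<close>, so the goal reduces to a
      diagonal statement for each single variable in \<open>vs\<close>.\<close>
    unfolding list.rel_map
    by (rule list.rel_refl_strong, rule list_all2_map_of_zip[OF assms(3) len])
      (use that in blast)
  from this[of "var_seq e1"] this[of "var_seq e2"] show ?thesis
    using assms(1,2) by (auto simp: distribution_def Let_def split: if_splits)
qed

lemma compute_UnOp_eq_Some:
  "compute D M (UnOp u e) xs = Some y \<longleftrightarrow>
     (\<exists>z. compute D M e xs = Some z \<and> M (Unary u) [z] = Some y)"
  by (auto simp: map_comp_def split: option.splits)

lemma compute_BinOp_eq_Some:
  "compute D M (BinOp e1 b e2) xs = Some y \<longleftrightarrow>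
     (\<exists>xs1 xs2 z1 z2. distribution e1 e2 D xs = Some (xs1, xs2) \<and>
        compute D M e1 xs1 = Some z1 \<and> compute D M e2 xs2 = Some z2 \<and>
        M (Binary b) [z1, z2] = Some y)"
  by (auto simp: map_comp_def pprod_def split: option.splits)

lemma set_extension_compute_UnOp:
  assumes e: "set_extension (length (var_seq e)) D (compute D M e) (compute (Pow D) M' e)"
    and u: "set_extension 1 D (M (Unary u)) (M' (Unary u))"
  shows "set_extension (length (var_seq (UnOp u e))) D
    (compute D M (UnOp u e)) (compute (Pow D) M' (UnOp u e))"
  unfolding set_extension_iff var_seq_simps
proof (intro conjI allI impI ballI)
  fix xs y assume "compute D M (UnOp u e) xs = Some y"
  then show "xs \<in> nlists (length (var_seq e)) D" "y \<in> D"
    unfolding compute_UnOp_eq_Some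
    using set_extension_SomeD[OF e] set_extension_SomeD[OF u] by blast+
next
  fix As assume "As \<notin> nlists (length (var_seq e)) (Pow D)"
  then show "compute (Pow D) M' (UnOp u e) As = None"
    using e by (simp add: set_extension_iff)
next
  fix As assume "As \<in> nlists (length (var_seq e)) (Pow D)"
  then obtain B where B: "compute (Pow D) M' e As = Some B" "B \<subseteq> D"
    "\<forall>xs y. list_all2 (\<in>) xs As \<longrightarrow> compute D M e xs = Some y \<longrightarrow> y \<in> B"
    by (rule set_extension_applyE[OF e])
  then have "[B] \<in> nlists 1 (Pow D)" by (simp add: nlists_def)
  then obtain C where C: "M' (Unary u) [B] = Some C" "C \<subseteq> D"
    "\<forall>xs y. list_all2 (\<in>) xs [B] \<longrightarrow> M (Unary u) xs = Some y \<longrightarrow> y \<in> C"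
    by (rule set_extension_applyE[OF u])
  \<comment> \<open>The intermediate value \<open>z\<close> lies in \<open>B\<close>, so
    \<open>[z]\<close> is componentwise in \<open>[B]\<close>, and the choice of \<open>C\<close>
    applies.\<close>
  have "y \<in> C" if "list_all2 (\<in>) xs As" "compute D M (UnOp u e) xs = Some y" for xs y
    using that B(3) C(3) unfolding compute_UnOp_eq_Some by fastforce
  then show "\<exists>C. compute (Pow D) M' (UnOp u e) As = Some C \<and> C \<subseteq> D \<and>
    (\<forall>xs y. list_all2 (\<in>) xs As \<longrightarrow> compute D M (UnOp u e) xs = Some y \<longrightarrow> y \<in> C)"
    using B(1) C(1,2) unfolding compute_UnOp_eq_Some by blast
qed

text \<open>A variable shared by \<open>e1\<close> and \<open>e2\<close> has one value in both
  operands, whereas \<open>[B1, B2]\<close> admits all pairs from \<open>B1\<close> and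
  \<open>B2\<close>. This only enlarges the resulting set, so the inclusion survives.\<close>

lemma set_extension_compute_BinOp:
  assumes e1: "set_extension (length (var_seq e1)) D (compute D M e1) (compute (Pow D) M' e1)"
    and e2: "set_extension (length (var_seq e2)) D (compute D M e2) (compute (Pow D) M' e2)"
    and b: "set_extension 2 D (M (Binary b)) (M' (Binary b))"
  shows "set_extension (length (var_seq (BinOp e1 b e2))) D
    (compute D M (BinOp e1 b e2)) (compute (Pow D) M' (BinOp e1 b e2))"
  (is "set_extension ?n D ?f ?F")
  unfolding set_extension_iff
proof (intro conjI allI impI ballI)
  fix xs y assume y: "?f xs = Some y"
  then show "y \<in> D"
    unfolding compute_BinOp_eq_Some using set_extension_SomeD[OF b] by blast
  \<comment> \<open>A value of \<open>?f\<close> at \<open>xs\<close> requires the distribution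
    function to be defined there, which fixes both the length and the range of the entries.\<close>
  show "xs \<in> nlists ?n D"
    using y distribution_eq_None_iff[of e1 e2 D xs b] unfolding compute_BinOp_eq_Some by force
next
  fix As assume "As \<notin> nlists ?n (Pow D)"
  then have "distribution e1 e2 (Pow D) As = None"
    using distribution_eq_None_iff[of e1 e2 "Pow D" As b] by blast
  then show "?F As = None" by simp
next
  fix As assume "As \<in> nlists ?n (Pow D)"
  then obtain As1 As2 where As: "distribution e1 e2 (Pow D) As = Some (As1, As2)"
    using distribution_eq_None_iff[of e1 e2 "Pow D" As b] by force
  then have As12: "As1 \<in> nlists (length (var_seq e1)) (Pow D)"
    "As2 \<in> nlists (length (var_seq e2)) (Pow D)"
    unfolding distribution_iff by blast+
  obtain B1 where B1: "compute (Pow D) M' e1 As1 = Some B1" "B1 \<subseteq> D"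
    "\<forall>xs y. list_all2 (\<in>) xs As1 \<longrightarrow> compute D M e1 xs = Some y \<longrightarrow> y \<in> B1"
    by (rule set_extension_applyE[OF e1 As12(1)])
  obtain B2 where B2: "compute (Pow D) M' e2 As2 = Some B2" "B2 \<subseteq> D"
    "\<forall>xs y. list_all2 (\<in>) xs As2 \<longrightarrow> compute D M e2 xs = Some y \<longrightarrow> y \<in> B2"
    by (rule set_extension_applyE[OF e2 As12(2)])
  have "[B1, B2] \<in> nlists 2 (Pow D)" using B1(2) B2(2) by (simp add: nlists_def)
  then obtain C where C: "M' (Binary b) [B1, B2] = Some C" "C \<subseteq> D"
    "\<forall>xs y. list_all2 (\<in>) xs [B1, B2] \<longrightarrow> M (Binary b) xs = Some y \<longrightarrow> y \<in> C"
    by (rule set_extension_applyE[OF b])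
  \<comment> \<open>The points \<open>xs\<close> and the sets \<open>As\<close> are distributed
    alike, so each half of \<open>xs\<close> is componentwise in the matching half of
    \<open>As\<close>; this puts \<open>z1\<close> in \<open>B1\<close> and \<open>z2\<close> in
    \<open>B2\<close>.\<close>
  have "y \<in> C" if xs: "list_all2 (\<in>) xs As" and y: "?f xs = Some y" for xs y
  proof -
    obtain xs1 xs2 z1 z2 where z: "distribution e1 e2 D xs = Some (xs1, xs2)"
      "compute D M e1 xs1 = Some z1" "compute D M e2 xs2 = Some z2"
      "M (Binary b) [z1, z2] = Some y"
      using y unfolding compute_BinOp_eq_Some by blast
    then have "z1 \<in> B1" "z2 \<in> B2"
      using distribution_list_all2[OF z(1) As xs] B1(3) B2(3) by blast+
    then show ?thesis using C(3)[rule_format, OF _ z(4)] by simp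
  qed
  then show "\<exists>C. ?F As = Some C \<and> C \<subseteq> D \<and>
    (\<forall>xs y. list_all2 (\<in>) xs As \<longrightarrow> ?f xs = Some y \<longrightarrow> y \<in> C)"
    using As B1(1) B2(1) C(1,2) unfolding compute_BinOp_eq_Some by blast
qed

theorem lemma2:
  fixes D :: "'d set"
    and e :: "('v, 'u, 'b) expr"
    and M :: "('u, 'b) opsym \<Rightarrow> 'd list \<rightharpoonup> 'd"
    and M' :: "('u, 'b) opsym \<Rightarrow> 'd set list \<rightharpoonup> 'd set"
  assumes "is_interp e D M"
    and "interp_set_extension e D M M'"
  shows "set_extension (length (var_seq e)) D (compute D M e) (compute (Pow D) M' e)"
proof -
  have "\<forall>p\<in>ops e. set_extension (arity p) D (M p) (M' p)"
    using assms(2) by (simp add: interp_set_extension_def)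
  \<comment> \<open>The condition on the symbols is chained into the induction, so each induction
    hypothesis asks for it only on the symbols of a subexpression, which are among those of the
    whole.\<close>
  then show ?thesis
  proof (induction e)
    case (Var v)
    \<comment> \<open>Both computed functions are the identity on one-element tuples, so the value
      at \<open>[A]\<close> is \<open>A\<close> itself.\<close>
    show ?case
      unfolding set_extension_iff
      by (auto simp: var_seq_simps nlists_def length_Suc_conv list_all2_Cons2 split: if_splits)
  next
    case (UnOp u e)
    then show ?case by (intro set_extension_compute_UnOp) simp_all
  next
    case (BinOp e1 b e2)
    then show ?case by (intro set_extension_compute_BinOp) simp_all
  qed
qed

end
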